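(* Let $c=(c_1,c_2)\in\mathbb{N}^2$ with $c_1\neq 0$, and let $S_c=\{0\}\cup\{x\in\mathbb{N}^2\mid x\succeq_{glex}c\}$ be the ordinary $\mathbb{N}^2$-semigroup with conductor $c$, ordered by $\preceq_{glex}$. Then the minimal system of generators of $S_c$ is $$\big[c,\,2c\big)_{\preceq_{glex}}\sqcup\big[(0,2\pi(c)+1),\;c+(0,\pi(c)+1)\big)_{\preceq_{glex}},$$ and its embedding dimension is $\mathrm{e}(S_c)=\dfrac{3\pi(c)^2+\pi(c)+4c_1}{2}$.
   Context: $\mathbb{N}$ contains $0$; for $x=(x_1,x_2)\in\mathbb{N}^2$, $\pi(x)=x_1+x_2$. The graded lexicographic order on $\mathbb{N}^2$ is: $x\prec_{glex}y$ iff $\pi(x)<\pi(y)$, or $\pi(x)=\pi(y)$ and $x_1<y_1$. The half-open interval is $[a,b)_{\preceq_{glex}}=\{x\in\mathbb{N}^2\mid a\preceq_{glex}x\prec_{glex}b\}$. The embedding dimension is the cardinality of the unique minimal system of generators. *)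

theory Defs
  imports Complex_Main "HOL-Library.Product_Plus"
begin

definition deg :: "nat \<times> nat \<Rightarrow> nat" where
  "deg x = fst x + snd x"

definition glex_less :: "nat \<times> nat \<Rightarrow> nat \<times> nat \<Rightarrow> bool"  (infix "\<prec>" 50) where
  "x \<prec> y \<longleftrightarrow> deg x < deg y \<or> deg x = deg y \<and> fst x < fst y"

definition glex_le :: "nat \<times> nat \<Rightarrow> nat \<times> nat \<Rightarrow> bool"  (infix "\<preceq>" 50) where
  "x \<preceq> y \<longleftrightarrow> x \<prec> y \<or> x = y"

definition glex_interval :: "nat \<times> nat \<Rightarrow> nat \<times> nat \<Rightarrow> (nat \<times> nat) set" where
  "glex_interval a b = {x. a \<preceq> x \<and> x \<prec> b}"

definition ordinary_semigroup :: "nat \<times> nat \<Rightarrow> (nat \<times> nat) set" where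
  "ordinary_semigroup c = {0} \<union> {x. c \<preceq> x}"

text \<open>
  The submonoid generated by a set consists of all finite sums of its elements, with repetition
  allowed; the empty sum contributes 0.
\<close>

definition generated :: "'a::comm_monoid_add set \<Rightarrow> 'a set" where
  "generated A = {sum_list xs | xs. set xs \<subseteq> A}"

definition minimal_generators :: "'a::comm_monoid_add set \<Rightarrow> 'a set \<Rightarrow> bool" where
  "minimal_generators S A \<longleftrightarrow> generated A = S \<and> (\<forall>B. B \<subset> A \<longrightarrow> generated B \<noteq> S)"

text \<open>
  Only meaningful when \<open>S\<close> has exactly one minimal system of generators.
\<close>

definition embedding_dimension :: "'a::comm_monoid_add set \<Rightarrow> nat" where
  "embedding_dimension S = card (THE A. minimal_generators S A)"

end

theory Submission
  imports Defs "HOL-Library.Nat_Bijection"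
begin

text \<open>
  Write \<open>d = \<pi>(c)\<close>. The minimal generators of a monoid graded by a positive degree are its
  atoms. A sum of two elements above \<open>c\<close> lies above \<open>2c\<close>. Conversely, everything above \<open>2c\<close>
  splits, except in degree \<open>2d + 1\<close>: there a sum has a summand of degree exactly \<open>d\<close>, whose first
  coordinate is at least \<open>c\<^sub>1\<close>, so the elements with first coordinate below \<open>c\<^sub>1\<close> remain atoms.
  For the count, the rank of an element in the graded lexicographic order is its image under
  Cantor's pairing function, so that intervals are counted by differences of ranks.
\<close>

section \<open>Atoms of commutative monoids\<close>

definition atoms :: "'a::comm_monoid_add set \<Rightarrow> 'a set" where
  "atoms S = {x \<in> S - {0}. \<nexists>y z. y \<in> S - {0} \<and> z \<in> S - {0} \<and> x = y + z}"

lemma zero_in_generated: "0 \<in> generated A"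
  unfolding generated_def by (auto intro: exI[of _ "[]"])

lemma generated_superset: "A \<subseteq> generated A"
proof
  fix x assume "x \<in> A"
  then have "x = sum_list [x] \<and> set [x] \<subseteq> A" by simp
  then show "x \<in> generated A" unfolding generated_def by blast
qed

lemma generated_add:
  assumes "x \<in> generated A" "y \<in> generated A"
  shows "x + y \<in> generated A"
proof -
  obtain xs ys where "x = sum_list xs" "set xs \<subseteq> A" "y = sum_list ys" "set ys \<subseteq> A"
    using assms unfolding generated_def by blast
  then have "x + y = sum_list (xs @ ys) \<and> set (xs @ ys) \<subseteq> A" by simp
  then show ?thesis unfolding generated_def by blast
qed

lemma generated_least:
  assumes "A \<subseteq> S" "0 \<in> S" "\<And>x y. x \<in> S \<Longrightarrow> y \<in> S \<Longrightarrow> x + y \<in> S"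
  shows "generated A \<subseteq> S"
proof -
  have "sum_list xs \<in> S" if "set xs \<subseteq> A" for xs
    using that by (induction xs) (use assms in auto)
  then show ?thesis unfolding generated_def by blast
qed

text \<open>When a list sums to an atom, either its head or the sum of its tail is 0. Dropping the
  zero part, induction reduces to a shorter list until the atom itself appears as an entry.\<close>

lemma atoms_subset_generating:
  assumes "generated A = S"
  shows "atoms S \<subseteq> A"
proof -
  have "sum_list xs \<in> A" if "set xs \<subseteq> A" "sum_list xs \<in> atoms S" for xs
    using that
  proof (induction xs)
    case Nil
    then show ?case by (simp add: atoms_def)
  next
    case (Cons a xs)
    have "a \<in> S" "sum_list xs \<in> S"
      using Cons.prems(1) assms generated_superset[of A] by (auto simp: generated_def)
    then have "a = 0 \<or> sum_list xs = 0"
      using Cons.prems(2) by (auto simp: atoms_def)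
    then show ?case using Cons by auto
  qed
  moreover have "atoms S \<subseteq> generated A"
    using assms by (auto simp: atoms_def)
  ultimately show ?thesis unfolding generated_def by blast
qed

text \<open>Strong induction on the weight \<open>w\<close>: a nonzero element that is not an atom
  splits into two nonzero summands, each of strictly smaller weight.\<close>

lemma generated_atoms:
  fixes w :: "'a::comm_monoid_add \<Rightarrow> nat"
  assumes "0 \<in> S" "\<And>x y. x \<in> S \<Longrightarrow> y \<in> S \<Longrightarrow> x + y \<in> S"
    and add: "\<And>x y. w (x + y) = w x + w y"
    and pos: "\<And>x. x \<in> S - {0} \<Longrightarrow> 0 < w x"
  shows "generated (atoms S) = S"
proof
  show "generated (atoms S) \<subseteq> S"
    using assms(1,2) by (intro generated_least) (auto simp: atoms_def)
  have "x \<in> generated (atoms S)" if "x \<in> S" for x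
    using that
  proof (induction "w x" arbitrary: x rule: less_induct)
    case less
    consider "x = 0" | "x \<in> atoms S"
      | y z where "y \<in> S - {0}" "z \<in> S - {0}" "x = y + z"
      using less.prems unfolding atoms_def by blast
    then show ?case
    proof cases
      case 1
      then show ?thesis by (simp add: zero_in_generated)
    next
      case 2
      then show ?thesis using generated_superset by blast
    next
      case 3
      then have "w y < w x" "w z < w x" using pos[of y] pos[of z] add by auto
      then show ?thesis using 3 less.hyps by (auto intro: generated_add)
    qed
  qed
  then show "S \<subseteq> generated (atoms S)" by blast
qed

text \<open>Atoms lie in every generating set. If they also generate, they form the least generating
  set, which gives minimality and uniqueness at once.\<close>

lemma minimal_generators_iff_atoms:
  assumes "generated (atoms S) = S"
  shows "minimal_generators S A \<longleftrightarrow> A = atoms S"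
proof
  assume A: "minimal_generators S A"
  then have "atoms S \<subseteq> A"
    by (simp add: minimal_generators_def atoms_subset_generating)
  moreover have "\<not> atoms S \<subset> A"
    using A assms by (auto simp: minimal_generators_def)
  ultimately show "A = atoms S" by blast
next
  assume A: "A = atoms S"
  have "generated B \<noteq> S" if "B \<subset> atoms S" for B
    using that atoms_subset_generating[of B S] by auto
  then show "minimal_generators S A"
    using assms A by (simp add: minimal_generators_def)
qed

section \<open>The graded lexicographic order\<close>

lemma deg_add: "deg (x + y) = deg x + deg y"
  by (simp add: deg_def)

lemma prod_encode_deg: "prod_encode x = triangle (deg x) + fst x"
  by (simp add: prod_encode_def deg_def split: prod.split)

lemma strict_mono_triangle: "strict_mono triangle"
  by (simp add: strict_mono_Suc_iff)

lemma glex_less_prod_encode: "x \<prec> y \<longleftrightarrow> prod_encode x < prod_encode y"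
proof -
  have less: "prod_encode x < prod_encode y" if "deg x < deg y" for x y
  proof -
    \<comment> \<open>Since \<open>fst x\<close> is at most \<open>deg x\<close>, the code stays
      below the start of the next diagonal.\<close>
    have "prod_encode x < triangle (Suc (deg x))"
      by (simp add: prod_encode_deg deg_def)
    also have "\<dots> \<le> triangle (deg y)"
      using that strict_mono_less_eq[OF strict_mono_triangle] by (simp del: triangle_Suc)
    finally show ?thesis by (simp add: prod_encode_deg)
  qed
  show ?thesis
    using less[of x y] less[of y x]
    by (cases "deg x" "deg y" rule: linorder_cases) (auto simp: glex_less_def prod_encode_deg)
qed

lemma glex_le_prod_encode: "x \<preceq> y \<longleftrightarrow> prod_encode x \<le> prod_encode y"
  by (auto simp: glex_le_def glex_less_prod_encode order.order_iff_strict)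

lemma glex_interval_vimage:
  "glex_interval a b = prod_encode -` {prod_encode a..<prod_encode b}"
  by (auto simp: glex_interval_def glex_le_prod_encode glex_less_prod_encode)

lemma finite_glex_interval: "finite (glex_interval a b)"
  by (simp add: glex_interval_vimage finite_vimageI inj_prod_encode)

lemma card_glex_interval: "card (glex_interval a b) = prod_encode b - prod_encode a"
  by (simp add: glex_interval_vimage card_vimage_inj inj_prod_encode surj_prod_encode)

lemma real_prod_encode: "real (prod_encode x) = real (deg x) * (real (deg x) + 1) / 2 + real (fst x)"
proof -
  \<comment> \<open>The doubled form avoids integer division and so carries over to the
    reals.\<close>
  have "2 * triangle n = n * (n + 1)" for n
    by (induction n) auto
  then have "2 * real (triangle (deg x)) = real (deg x) * (real (deg x) + 1)"
    by (metis of_nat_1 of_nat_add of_nat_mult of_nat_numeral)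
  then show ?thesis
    by (simp add: prod_encode_deg)
qed

lemma glex_le_iff: "x \<preceq> y \<longleftrightarrow> deg x < deg y \<or> deg x = deg y \<and> fst x \<le> fst y"
  by (cases x; cases y) (auto simp: glex_le_def glex_less_def deg_def)

lemma glex_sum_iff:
  "(\<exists>y z. c \<preceq> y \<and> c \<preceq> z \<and> x = y + z) \<longleftrightarrow>
    c + c \<preceq> x \<and> x \<notin> glex_interval (0, 2 * deg c + 1) (c + (0, deg c + 1))"
    (is "?L \<longleftrightarrow> ?R")
proof
  assume ?L
  then obtain y z where "c \<preceq> y" "c \<preceq> z" "x = y + z" by blast
  then show ?R
    by (auto simp: glex_interval_def glex_le_iff glex_less_def deg_def)
next
  assume R: ?R
  obtain a b p q where c: "c = (a, b)" and x: "x = (p, q)" by (metis prod.exhaust)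
  \<comment> \<open>The bounds on \<open>u\<close> and \<open>v\<close> keep the truncated
    subtractions exact, so that the two pairs add up to \<open>x\<close>.\<close>
  have split: ?L
    if "u \<le> p" "v \<le> q" "c \<preceq> (u, v)" "c \<preceq> (p - u, q - v)" for u v
    using that by (intro exI[of _ "(u, v)"] exI[of _ "(p - u, q - v)"]) (auto simp: x)
  have "2 * (a + b) < p + q \<or> 2 * (a + b) = p + q \<and> 2 * a \<le> p"
    using R by (auto simp: c x glex_le_iff deg_def)
  \<comment> \<open>Both endpoints of the excluded interval have degree
    \<open>2 * (a + b) + 1\<close>; their first coordinates are 0 and \<open>a\<close>.\<close>
  moreover have "\<not> (p + q = 2 * (a + b) + 1 \<and> p < a)"
    using R by (auto simp: c x glex_interval_def glex_le_iff glex_less_def deg_def)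
  ultimately consider "p + q = 2 * (a + b)" "2 * a \<le> p" "p \<le> 2 * a + b"
    | "p + q = 2 * (a + b)" "2 * a + b < p"
    | "p + q = 2 * (a + b) + 1" "a \<le> p"
    | "2 * (a + b) + 2 \<le> p + q"
    by linarith
  then show ?L
  proof cases
    case 1
    \<comment> \<open>Here \<open>b \<le> q\<close>, so \<open>c\<close> itself can be
      subtracted.\<close>
    then show ?thesis by (intro split[of a b]) (auto simp: c glex_le_iff deg_def)
  next
    case 2
    \<comment> \<open>Now \<open>q < b\<close>, so \<open>c\<close> no longer fits. The last element
      of its degree does, and it leaves first coordinate \<open>p - (a + b) > a\<close>.\<close>
    then show ?thesis by (intro split[of "a + b" 0]) (auto simp: c glex_le_iff deg_def)
  next
    case 3
    \<comment> \<open>The summand of degree \<open>a + b\<close> gets the largest first coordinate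
      that fits, which is at least \<open>a\<close>. The remainder has degree
      \<open>a + b + 1\<close>, hence lies above \<open>c\<close>.\<close>
    define u where "u = min p (a + b)"
    show ?thesis using 3
      by (intro split[of u "a + b - u"]) (auto simp: u_def c glex_le_iff deg_def)
  next
    case 4
    \<comment> \<open>Both summands have degree at least \<open>a + b + 1\<close>, so they lie above
      \<open>c\<close> whatever their first coordinates.\<close>
    define u where "u = min p (a + b + 1)"
    show ?thesis using 4
      by (intro split[of u "a + b + 1 - u"]) (auto simp: u_def c glex_le_iff deg_def)
  qed
qed

section \<open>Ordinary semigroups\<close>

text \<open>A nonzero first coordinate makes \<open>deg c\<close> positive, so 0 is not above
  \<open>c\<close>.\<close>

lemma ordinary_semigroup_nonzero:
  assumes "fst c \<noteq> 0"
  shows "ordinary_semigroup c - {0} = {x. c \<preceq> x}"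
  using assms by (auto simp: ordinary_semigroup_def glex_le_iff deg_def)

lemma atoms_ordinary_semigroup:
  assumes "fst c \<noteq> 0"
  shows "atoms (ordinary_semigroup c) =
    glex_interval c (c + c) \<union> glex_interval (0, 2 * deg c + 1) (c + (0, deg c + 1))"
proof -
  have "atoms (ordinary_semigroup c) = {x. c \<preceq> x \<and> \<not> (\<exists>y z. c \<preceq> y \<and> c \<preceq> z \<and> x = y + z)}"
    unfolding atoms_def ordinary_semigroup_nonzero[OF assms] by simp
  also have "\<dots> = {x. c \<preceq> x \<and> \<not> c + c \<preceq> x}
      \<union> ({x. c \<preceq> x} \<inter> glex_interval (0, 2 * deg c + 1) (c + (0, deg c + 1)))"
    unfolding glex_sum_iff by blast
  also have "{x. c \<preceq> x \<and> \<not> c + c \<preceq> x} = glex_interval c (c + c)"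
    by (auto simp: glex_interval_def glex_le_prod_encode glex_less_prod_encode)
  also have "{x. c \<preceq> x} \<inter> glex_interval (0, 2 * deg c + 1) (c + (0, deg c + 1))
      = glex_interval (0, 2 * deg c + 1) (c + (0, deg c + 1))"
    by (auto simp: glex_interval_def glex_le_iff deg_def)
  finally show ?thesis .
qed

lemma generated_atoms_ordinary_semigroup:
  assumes "fst c \<noteq> 0"
  shows "generated (atoms (ordinary_semigroup c)) = ordinary_semigroup c"
proof (rule generated_atoms[where w = deg])
  show "0 < deg x" if "x \<in> ordinary_semigroup c - {0}" for x
    using that assms unfolding ordinary_semigroup_nonzero[OF assms]
    by (auto simp: glex_le_iff deg_def)
qed (auto simp: ordinary_semigroup_def glex_le_iff deg_add)

theorem proposition30:
  fixes c :: "nat \<times> nat"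
  assumes "fst c \<noteq> 0"
  defines "G \<equiv> glex_interval c (c + c)"
    and "H \<equiv> glex_interval (0, 2 * deg c + 1) (c + (0, deg c + 1))"
  shows "G \<inter> H = {}
    \<and> minimal_generators (ordinary_semigroup c) (G \<union> H)
    \<and> (\<forall>A. minimal_generators (ordinary_semigroup c) A \<longrightarrow> A = G \<union> H)
    \<and> real (embedding_dimension (ordinary_semigroup c))
        = (3 * real (deg c) ^ 2 + real (deg c) + 4 * real (fst c)) / 2"
proof -
  \<comment> \<open>Elements of \<open>G\<close> have degree at most \<open>2 * deg c\<close>, those
    of \<open>H\<close> exactly \<open>2 * deg c + 1\<close>.\<close>
  have disj: "G \<inter> H = {}"
    by (auto simp: G_def H_def glex_interval_def glex_le_iff glex_less_def deg_def)
  have min_iff: "minimal_generators (ordinary_semigroup c) A \<longleftrightarrow> A = G \<union> H" for A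
    using minimal_generators_iff_atoms[OF generated_atoms_ordinary_semigroup[OF assms(1)]]
      atoms_ordinary_semigroup[OF assms(1)]
    by (simp add: G_def H_def)
  \<comment> \<open>This makes the natural-number difference of ranks a true difference over the
    reals.\<close>
  have "prod_encode c \<le> prod_encode (c + c)"
    by (auto simp: glex_le_prod_encode[symmetric] glex_le_iff deg_add)
  then have G: "real (card G) = real (prod_encode (c + c)) - real (prod_encode c)"
    by (simp add: G_def card_glex_interval)
  \<comment> \<open>With equal degrees the triangular parts of the two ranks cancel, leaving
    \<open>fst c - 0\<close>.\<close>
  have "deg (c + (0, deg c + 1)) = 2 * deg c + 1" "deg (0, 2 * deg c + 1) = 2 * deg c + 1"
    by (simp_all add: deg_def)
  then have H: "card H = fst c"
    by (simp add: H_def card_glex_interval prod_encode_deg)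
  have "finite G" "finite H"
    by (simp_all add: G_def H_def finite_glex_interval)
  then have "embedding_dimension (ordinary_semigroup c) = card G + card H"
    using disj by (simp add: embedding_dimension_def min_iff card_Un_disjoint)
  also have "real \<dots> = real (card G) + real (fst c)"
    by (simp add: H)
  also have "\<dots> = (2 * real (deg c) * (2 * real (deg c) + 1) / 2 + 2 * real (fst c))
      - (real (deg c) * (real (deg c) + 1) / 2 + real (fst c)) + real (fst c)"
    by (simp add: G real_prod_encode deg_add)
  also have "\<dots> = (3 * real (deg c) ^ 2 + real (deg c) + 4 * real (fst c)) / 2"
    by (simp add: power2_eq_square field_simps)
  finally have "real (embedding_dimension (ordinary_semigroup c))
      = (3 * real (deg c) ^ 2 + real (deg c) + 4 * real (fst c)) / 2" .
  with disj min_iff show ?thesis by blast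
qed

end
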